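(* Let $\gamma$ be a probability measure on $\mathcal{Y}$, let the marginal performance measure $H^g:\mathcal{Y}\to\mathbf{R}$ be measurable, and suppose that $\Lambda_\gamma(c,H^g)$ is finite for $c$ in a neighborhood of $0$. Let $\lambda$ be a probability measure on $\mathcal{Y}$ with $\mathcal{R}(\lambda\mid\gamma)<\infty$, and let $\rho:=\mathcal{R}(\lambda\mid\gamma)$. Let $P=\gamma\otimes\nu$. Then $$-\inf_{c>0}\Big\{\Lambda_\gamma(c,-H^g)+\frac{\rho}{c}\Big\}\;\le\;\mathbf{E}_Q[g(\bar u)]-\mathbf{E}_P[g(\bar u)]\;\le\;\inf_{c>0}\Big\{\Lambda_\gamma(c,H^g)+\frac{\rho}{c}\Big\}$$ for all $Q=\eta\otimes\nu$, with $\eta$ a probability measure on $\mathcal{Y}$ such that $\mathcal{R}(\eta\mid\gamma)\le\rho$.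
   Context: Let $\mathcal{Y},\mathcal{Z}$ be Polish spaces, and let $\nu(dz\mid y)$ be a probability kernel from $\mathcal{Y}$ to $\mathcal{Z}$. (In the application, $y$ is a discretized random coefficient field and $z$ is the discrete solution $\bar u$ of a random PDE given $y$.) The quantity of interest is represented as $g(\bar u)=h(y,z)$ for a measurable $h:\mathcal{Y}\times\mathcal{Z}\to\mathbf{R}$. The marginal performance measure is $$H^g(y)=\int_{\mathcal{Z}}h(y,z)\,\nu(dz\mid y),\qquad y\in\mathcal{Y}.$$ For a probability measure $\eta$ on $\mathcal{Y}$, $\eta\otimes\nu$ denotes the measure $\nu(dz\mid y)\eta(dy)$ on $\mathcal{Y}\times\mathcal{Z}$, and the expectation under $Q=\eta\otimes\nu$ is the iterated integral $$\mathbf{E}_Q[g(\bar u)]=\int_{\mathcal{Y}}\int_{\mathcal{Z}}h(y,z)\,\nu(dz\mid y)\,\eta(dy)=\mathbf{E}_\eta[H^g];$$ likewise for $P=\gamma\otimes\nu$. Relative entropy: $\mathcal{R}(\lambda\mid\gamma)=\int\log\frac{d\lambda}{d\gamma}\,d\lambda$ if $\lambda\ll\gamma$, and $+\infty$ otherwise. Risk-sensitive performance measure: for $F=\pm H^g$, $$\Lambda_\gamma(c,F)=\frac1c\log\mathbf{E}_\gamma\big[e^{c(F-\mathbf{E}_\gamma[F])}\big],$$ with values in $(-\infty,+\infty]$; "finite in a neighborhood of $c=0$" means that there is $c_0>0$ with $\mathbf{E}_\gamma[e^{cH^g}]<\infty$ for all $|c|<c_0$. *)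

theory Defs
  imports "HOL-Probability.Probability"
begin

text \<open>
  Integral of a real function with values in the extended reals: it is \<open>\<infinity>\<close> (rather than
  the default value 0 of the Bochner integral) when only the positive part has infinite integral.
\<close>

definition ext_integral :: "'a measure \<Rightarrow> ('a \<Rightarrow> real) \<Rightarrow> ereal" where
  "ext_integral M f =
     enn2ereal (\<integral>\<^sup>+ x. ennreal (f x) \<partial>M) - enn2ereal (\<integral>\<^sup>+ x. ennreal (- f x) \<partial>M)"

text \<open>
  \<open>relative_entropy L G\<close> is the relative entropy of \<open>L\<close> with respect to \<open>G\<close>.
  The library writes \<open>absolutely_continuous G L\<close> for \<open>L \<lless> G\<close>, and
  \<open>entropy_density (exp 1) G L\<close> is the natural logarithm of \<open>dL/dG\<close>. For probability
  measures the negative part of \<open>ln (dL/dG)\<close> is always \<open>L\<close>-integrable, so the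
  extended integral never has the form \<open>\<infinity> - \<infinity>\<close>.
\<close>

definition relative_entropy :: "'a measure \<Rightarrow> 'a measure \<Rightarrow> ereal" where
  "relative_entropy L G =
     (if absolutely_continuous G L then ext_integral L (entropy_density (exp 1) G L) else \<infinity>)"

text \<open>
  The value is \<open>\<infinity>\<close> whenever the exponential moment is infinite, which agrees with
  \<open>(1/c) log \<infinity>\<close> for \<open>c > 0\<close>.
\<close>

definition risk_sensitive :: "'a measure \<Rightarrow> real \<Rightarrow> ('a \<Rightarrow> real) \<Rightarrow> ereal" where
  "risk_sensitive G c F =
     (let I = (\<integral>\<^sup>+ y. ennreal (exp (c * (F y - (\<integral>x. F x \<partial>G)))) \<partial>G)
      in if I = \<infinity> then \<infinity> else ereal (1 / c * ln (enn2real I)))"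

definition finite_exp_moments_near_0 :: "'a measure \<Rightarrow> ('a \<Rightarrow> real) \<Rightarrow> bool" where
  "finite_exp_moments_near_0 G F \<longleftrightarrow>
     (\<exists>c0>0. \<forall>c::real. \<bar>c\<bar> < c0 \<longrightarrow> (\<integral>\<^sup>+ y. ennreal (exp (c * F y)) \<partial>G) < \<infinity>)"

definition marginal_performance ::
    "('y \<Rightarrow> 'z measure) \<Rightarrow> ('y \<times> 'z \<Rightarrow> real) \<Rightarrow> 'y \<Rightarrow> real" where
  "marginal_performance \<nu> h y = (\<integral>z. h (y, z) \<partial>\<nu> y)"

definition kernel_measure ::
    "'y::topological_space measure \<Rightarrow> ('y \<Rightarrow> 'z::topological_space measure) \<Rightarrow> ('y \<times> 'z) measure" where
  "kernel_measure \<eta> \<nu> = \<eta> \<bind> (\<lambda>y. distr (\<nu> y) (borel \<Otimes>\<^sub>M borel) (Pair y))"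

text \<open>
  The expectation of \<open>h\<close> under \<open>kernel_measure \<eta> \<nu>\<close> is the iterated integral. It agrees
  with the integral with respect to the joint measure whenever \<open>h\<close> is integrable for the latter,
  see \<open>kernel_expectation_eq_integral\<close> below, but it does not require joint integrability.
\<close>

definition kernel_expectation ::
    "'y measure \<Rightarrow> ('y \<Rightarrow> 'z measure) \<Rightarrow> ('y \<times> 'z \<Rightarrow> real) \<Rightarrow> real" where
  "kernel_expectation \<eta> \<nu> h = (\<integral>y. (\<integral>z. h (y, z) \<partial>\<nu> y) \<partial>\<eta>)"

lemma nn_integral_kernel_measure:
  fixes \<eta> :: "'y::topological_space measure" and \<nu> :: "'y \<Rightarrow> 'z::topological_space measure"
  assumes [simp, measurable_cong]: "sets \<eta> = sets borel"
    and \<nu> [measurable]: "\<nu> \<in> borel \<rightarrow>\<^sub>M prob_algebra borel"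
    and f [measurable]: "f \<in> borel_measurable (borel \<Otimes>\<^sub>M borel)"
  shows "(\<integral>\<^sup>+ x. f x \<partial>kernel_measure \<eta> \<nu>) = (\<integral>\<^sup>+ y. \<integral>\<^sup>+ z. f (y, z) \<partial>\<nu> y \<partial>\<eta>)"
proof -
  have [measurable]: "\<nu> \<in> borel \<rightarrow>\<^sub>M subprob_algebra borel"
    using \<nu> by (rule measurable_prob_algebraD)
  have sets_\<nu> [measurable_cong]: "sets (\<nu> y) = sets borel" for y
    using measurable_space[OF \<nu>, of y] by (auto simp: space_prob_algebra)
  have "(\<lambda>y. distr (\<nu> y) (borel \<Otimes>\<^sub>M borel) (Pair y)) \<in> \<eta> \<rightarrow>\<^sub>M subprob_algebra (borel \<Otimes>\<^sub>M borel)"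
    by (rule measurable_distr2[where M = borel]) auto
  then show ?thesis
    unfolding kernel_measure_def
    by (subst nn_integral_bind[OF f]) (auto intro!: nn_integral_cong nn_integral_distr)
qed

lemma kernel_expectation_eq_integral:
  fixes \<eta> :: "'y::topological_space measure" and \<nu> :: "'y \<Rightarrow> 'z::topological_space measure"
  assumes "prob_space \<eta>" and sets_\<eta> [simp, measurable_cong]: "sets \<eta> = sets borel"
    and \<nu> [measurable]: "\<nu> \<in> borel \<rightarrow>\<^sub>M prob_algebra borel"
    and h [measurable]: "h \<in> borel_measurable (borel \<Otimes>\<^sub>M borel)"
    and int: "integrable (kernel_measure \<eta> \<nu>) h"
  shows "kernel_expectation \<eta> \<nu> h = (\<integral>x. h x \<partial>kernel_measure \<eta> \<nu>)"
proof -
  have [measurable]: "\<nu> \<in> borel \<rightarrow>\<^sub>M subprob_algebra borel"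
    using \<nu> by (rule measurable_prob_algebraD)
  have sets_\<nu> [measurable_cong]: "sets (\<nu> y) = sets borel" for y
    using measurable_space[OF \<nu>, of y] by (auto simp: space_prob_algebra)
  define p where "p y = (\<integral>\<^sup>+ z. ennreal (h (y, z)) \<partial>\<nu> y)" for y
  define n where "n y = (\<integral>\<^sup>+ z. ennreal (- h (y, z)) \<partial>\<nu> y)" for y
  have [measurable]: "p \<in> borel_measurable borel" "n \<in> borel_measurable borel"
    unfolding p_def n_def by (rule nn_integral_measurable_subprob_algebra2[where N = borel]; measurable)+
  have P: "(\<integral>\<^sup>+ x. ennreal (h x) \<partial>kernel_measure \<eta> \<nu>) = (\<integral>\<^sup>+ y. p y \<partial>\<eta>)"
    and N: "(\<integral>\<^sup>+ x. ennreal (- h x) \<partial>kernel_measure \<eta> \<nu>) = (\<integral>\<^sup>+ y. n y \<partial>\<eta>)"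
    unfolding p_def n_def by (rule nn_integral_kernel_measure; simp)+
  have fin: "(\<integral>\<^sup>+ y. p y \<partial>\<eta>) \<noteq> \<infinity>" "(\<integral>\<^sup>+ y. n y \<partial>\<eta>) \<noteq> \<infinity>"
    using int unfolding P[symmetric] N[symmetric] real_integrable_def by auto
  have p: "AE y in \<eta>. p y \<noteq> \<infinity>" and n: "AE y in \<eta>. n y \<noteq> \<infinity>"
    by (rule nn_integral_PInf_AE[OF _ fin(1)], simp) (rule nn_integral_PInf_AE[OF _ fin(2)], simp)
  have p': "(\<integral>\<^sup>+ y. ennreal (enn2real (p y)) \<partial>\<eta>) = (\<integral>\<^sup>+ y. p y \<partial>\<eta>)"
    using p by (intro nn_integral_cong_AE) (auto simp: top.not_eq_extremum)
  have n': "(\<integral>\<^sup>+ y. ennreal (enn2real (n y)) \<partial>\<eta>) = (\<integral>\<^sup>+ y. n y \<partial>\<eta>)"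
    using n by (intro nn_integral_cong_AE) (auto simp: top.not_eq_extremum)
  have ip: "integrable \<eta> (\<lambda>y. enn2real (p y))" and "integrable \<eta> (\<lambda>y. enn2real (n y))"
    using fin p' n' by (auto intro!: integrableI_nonneg simp: top.not_eq_extremum)
  have "kernel_expectation \<eta> \<nu> h = (\<integral>y. enn2real (p y) - enn2real (n y) \<partial>\<eta>)"
    unfolding kernel_expectation_def
  proof (rule integral_cong_AE)
    show "(\<lambda>y. \<integral>z. h (y, z) \<partial>\<nu> y) \<in> borel_measurable \<eta>"
    proof -
      have "(\<lambda>y. distr (\<nu> y) (borel \<Otimes>\<^sub>M borel) (Pair y)) \<in> \<eta> \<rightarrow>\<^sub>M subprob_algebra (borel \<Otimes>\<^sub>M borel)"
        by (rule measurable_distr2[where M = borel]) auto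
      from measurable_compose[OF this integral_measurable_subprob_algebra[OF h]]
      show ?thesis
        by (simp add: integral_distr)
    qed
    show "AE y in \<eta>. (\<integral>z. h (y, z) \<partial>\<nu> y) = enn2real (p y) - enn2real (n y)"
      using p n
    proof eventually_elim
      case (elim y)
      then have "integrable (\<nu> y) (\<lambda>z. h (y, z))"
        by (auto simp: real_integrable_def p_def n_def)
      then show ?case
        by (simp add: real_lebesgue_integral_def p_def n_def)
    qed
  qed measurable
  also have "\<dots> = (\<integral>y. enn2real (p y) \<partial>\<eta>) - (\<integral>y. enn2real (n y) \<partial>\<eta>)"
    by (rule Bochner_Integration.integral_diff) fact+
  also have "\<dots> = enn2real (\<integral>\<^sup>+ y. p y \<partial>\<eta>) - enn2real (\<integral>\<^sup>+ y. n y \<partial>\<eta>)"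
    using p' n' by (simp add: integral_eq_nn_integral)
  also have "\<dots> = (\<integral>x. h x \<partial>kernel_measure \<eta> \<nu>)"
    using int by (simp add: real_lebesgue_integral_def P N)
  finally show ?thesis .
qed

end

theory Submission
  imports Defs
begin

text \<open>
  Everything rests on one scalar inequality, the Fenchel-Young inequality
  \<open>u x \<le> x ln x - x + e\<^sup>u\<close> for \<open>x \<ge> 0\<close>, with \<open>x\<close> the density
  \<open>D = d\<eta>/d\<gamma>\<close> at a point. Integrated against \<open>\<gamma>\<close>, it bounds \<open>\<eta>\<close>-integrals by the
  entropy \<open>\<integral> D ln D d\<gamma>\<close> and exponential moments under \<open>\<gamma>\<close>. It is applied three times.

  With \<open>u = 0\<close> it shows that the negative part of \<open>D ln D\<close> is integrable, so a finite
  relative entropy really is the Bochner integral of \<open>D ln D\<close> (\<open>finite_relative_entropyE\<close>).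
  With \<open>u = \<bar>F\<bar>\<close>, where \<open>F = c H\<close> for a small \<open>c\<close>, it shows that \<open>H\<close> is \<open>\<eta>\<close>-integrable
  (\<open>integrable_if_exp_moments\<close>). With \<open>u = F - ln (\<integral> e\<^sup>F d\<gamma>)\<close> the last two terms of the
  inequality integrate to \<open>-1\<close> and \<open>1\<close> and cancel, which leaves the Donsker-Varadhan
  (Gibbs) inequality \<open>\<integral> F d\<eta> \<le> ln (\<integral> e\<^sup>F d\<gamma>) + \<R>(\<eta> | \<gamma>)\<close>.

  Putting \<open>c (F - \<integral> F d\<gamma>)\<close> for \<open>F\<close> there and dividing by \<open>c > 0\<close> gives the upper bound for every
  \<open>c\<close> (\<open>mean_difference_le_risk_sensitive\<close>); the upper half of the theorem is this bound for
  \<open>F = H\<close>, the lower half the same bound for \<open>F = -H\<close>. Only the marginal \<open>\<eta>\<close> of \<open>Q\<close> enters,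
  since both expectations are integrals of \<open>H\<close>.
\<close>

text \<open>
  Fenchel-Young: \<open>exp\<close> is convex, with conjugate \<open>x ln x - x\<close>. The inequality is the tangent line bound
  \<open>1 + t \<le> e\<^sup>t\<close> at \<open>t = u - ln x\<close>, multiplied by \<open>x\<close>.
\<close>

lemma mult_le_entropy_plus_exp:
  fixes u x :: real
  assumes "0 \<le> x"
  shows "x * u \<le> x * ln x - x + exp u"
proof (cases "x = 0")
  case False
  with assms have "0 < x" by simp
  then have "x * (1 + (u - ln x)) \<le> x * exp (u - ln x)"
    by (intro mult_left_mono exp_ge_add_one_self) auto
  also have "\<dots> = exp u"
    using \<open>0 < x\<close> by (simp add: exp_diff)
  finally show ?thesis
    by (simp add: algebra_simps)
qed simp

text \<open>
  Turns a finite \<open>relative_entropy\<close>, an extended integral against \<open>\<eta>\<close>, into a real-valued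
  integral against \<open>\<gamma>\<close>. Since \<open>D (- ln D) \<le> 1 - D \<le> 1\<close>, the negative part is
  integrable; finiteness of the difference then controls the positive part.
\<close>

lemma finite_relative_entropyE:
  assumes "prob_space \<gamma>" "prob_space \<eta>" and sets: "sets \<eta> = sets \<gamma>"
    and fin: "relative_entropy \<eta> \<gamma> < \<infinity>"
  obtains D :: "'a \<Rightarrow> real" where
    "D \<in> borel_measurable \<gamma>" "\<And>x. 0 \<le> D x" "\<eta> = density \<gamma> (\<lambda>x. ennreal (D x))"
    "integrable \<gamma> D" "(\<integral>x. D x \<partial>\<gamma>) = 1"
    "integrable \<gamma> (\<lambda>x. D x * ln (D x))"
    "relative_entropy \<eta> \<gamma> = ereal (\<integral>x. D x * ln (D x) \<partial>\<gamma>)"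
proof -
  interpret G: prob_space \<gamma> by fact
  interpret E: prob_space \<eta> by fact
  have ac: "absolutely_continuous \<gamma> \<eta>"
    using fin by (auto simp: relative_entropy_def split: if_splits)
  define D where "D x = enn2real (RN_deriv \<gamma> \<eta> x)" for x
  have D_meas [measurable]: "D \<in> borel_measurable \<gamma>"
    unfolding D_def by measurable
  have D_nonneg: "0 \<le> D x" for x
    by (simp add: D_def)
  have D_eq: "AE x in \<gamma>. ennreal (D x) = RN_deriv \<gamma> \<eta> x"
    using G.RN_deriv_finite[OF E.sigma_finite_measure_axioms ac sets]
    by (auto simp: D_def top.not_eq_extremum)
  have dens: "\<eta> = density \<gamma> (\<lambda>x. ennreal (D x))"
  proof -
    have "\<eta> = density \<gamma> (RN_deriv \<gamma> \<eta>)"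
      using G.density_RN_deriv[OF ac sets] by simp
    also have "\<dots> = density \<gamma> (\<lambda>x. ennreal (D x))"
      using D_eq by (intro density_cong) auto
    finally show ?thesis .
  qed
  have int_iff: "integrable \<eta> g \<longleftrightarrow> integrable \<gamma> (\<lambda>x. D x * g x)"
    and int_eq: "(\<integral>x. g x \<partial>\<eta>) = (\<integral>x. D x * g x \<partial>\<gamma>)"
    if "g \<in> borel_measurable \<gamma>" for g :: "'a \<Rightarrow> real"
    using that by (simp_all add: dens integrable_real_density integral_real_density D_nonneg)
  have D_int: "integrable \<gamma> D" and D_one: "(\<integral>x. D x \<partial>\<gamma>) = 1"
    using int_iff[of "\<lambda>_. 1"] int_eq[of "\<lambda>_. 1"] E.prob_space by simp_all

  define P where "P = (\<integral>\<^sup>+ x. ennreal (ln (D x)) \<partial>\<eta>)"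
  define N where "N = (\<integral>\<^sup>+ x. ennreal (- ln (D x)) \<partial>\<eta>)"
  have rel: "relative_entropy \<eta> \<gamma> = enn2ereal P - enn2ereal N"
    using ac by (simp add: relative_entropy_def ext_integral_def entropy_density_def log_def
        D_def P_def N_def comp_def)
  have "N = (\<integral>\<^sup>+ x. ennreal (D x * - ln (D x)) \<partial>\<gamma>)"
    unfolding N_def by (subst dens, subst nn_integral_density) (auto simp: D_nonneg simp flip: ennreal_mult')
  also have "\<dots> \<le> (\<integral>\<^sup>+ x. 1 \<partial>\<gamma>)"
  proof (intro nn_integral_mono)
    fix x
    have "D x * - ln (D x) \<le> 1"
      using mult_le_entropy_plus_exp[OF D_nonneg, of x 0] D_nonneg[of x] by simp
    then show "ennreal (D x * - ln (D x)) \<le> 1"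
      using ennreal_leI by fastforce
  qed
  also have "\<dots> = 1"
    by (simp add: G.emeasure_space_1)
  finally have N_fin: "N < \<infinity>"
    by (rule order.strict_trans1) simp
  have P_fin: "P < \<infinity>"
    using fin N_fin by (cases P; cases N) (auto simp: rel)
  have ln_meas: "(\<lambda>x. ln (D x)) \<in> borel_measurable \<gamma>"
    by measurable
  have ln_int: "integrable \<eta> (\<lambda>x. ln (D x))"
    using P_fin N_fin ln_meas unfolding real_integrable_def P_def N_def
    by (auto simp: measurable_cong_sets[OF sets refl])
  have "relative_entropy \<eta> \<gamma> = ereal (\<integral>x. ln (D x) \<partial>\<eta>)"
    using P_fin N_fin unfolding rel real_lebesgue_integral_def[OF ln_int] P_def[symmetric] N_def[symmetric]
    by (cases P; cases N) auto
  then show ?thesis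
    using that[OF D_meas D_nonneg dens D_int D_one] ln_int int_iff[OF ln_meas] int_eq[OF ln_meas] by simp
qed

text \<open>
  Fenchel-Young with \<open>u = \<bar>F\<bar>\<close> dominates \<open>D \<bar>F\<bar>\<close>. Both signs of the exponent are assumed because
  \<open>e\<^sup>F\<close> alone controls only the positive part of \<open>F\<close>.
\<close>

lemma integrable_if_exp_moments:
  fixes F :: "'a \<Rightarrow> real"
  assumes "prob_space \<gamma>" "prob_space \<eta>" "sets \<eta> = sets \<gamma>"
    and fin: "relative_entropy \<eta> \<gamma> < \<infinity>"
    and F [measurable]: "F \<in> borel_measurable \<gamma>"
    and exp: "integrable \<gamma> (\<lambda>x. exp (F x))" "integrable \<gamma> (\<lambda>x. exp (- F x))"
  shows "integrable \<eta> F"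
proof -
  from assms(1-4) obtain D where D [measurable]: "D \<in> borel_measurable \<gamma>" and D_nonneg: "\<And>x. 0 \<le> D x"
    and dens: "\<eta> = density \<gamma> (\<lambda>x. ennreal (D x))" and D_int: "integrable \<gamma> D"
    and ent: "integrable \<gamma> (\<lambda>x. D x * ln (D x))"
    by (rule finite_relative_entropyE) (rule that)
  have "integrable \<gamma> (\<lambda>x. D x * F x)"
  proof (rule Bochner_Integration.integrable_bound)
    show "integrable \<gamma> (\<lambda>x. D x * ln (D x) + (exp (F x) + exp (- F x)))"
      using ent exp by simp
    have "\<bar>D x * F x\<bar> \<le> D x * ln (D x) + (exp (F x) + exp (- F x))" for x
    proof -
      have "\<bar>D x * F x\<bar> = D x * \<bar>F x\<bar>"
        using D_nonneg[of x] by (simp add: abs_mult)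
      also have "\<dots> \<le> D x * ln (D x) - D x + exp \<bar>F x\<bar>"
        by (rule mult_le_entropy_plus_exp[OF D_nonneg])
      also have "\<dots> \<le> D x * ln (D x) + (exp (F x) + exp (- F x))"
        using D_nonneg[of x] exp_gt_zero[of "F x"] exp_gt_zero[of "- F x"]
        by (cases "0 \<le> F x") (simp_all add: abs_if del: exp_gt_zero)
      finally show ?thesis .
    qed
    then show "AE x in \<gamma>. norm (D x * F x) \<le> norm (D x * ln (D x) + (exp (F x) + exp (- F x)))"
      by (auto intro: order_trans[OF _ abs_ge_self])
  qed measurable
  then show ?thesis
    by (simp add: dens integrable_real_density D_nonneg)
qed

text \<open>
  The Donsker-Varadhan inequality. Subtracting \<open>ln (\<integral> e\<^sup>F d\<gamma>)\<close> from \<open>F\<close> normalizes \<open>e\<^sup>F\<close> to a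
  probability density; among all constant shifts it gives the best bound from Fenchel-Young.
\<close>

lemma Donsker_Varadhan_inequality:
  fixes F :: "'a \<Rightarrow> real"
  assumes "prob_space \<gamma>" "prob_space \<eta>" "sets \<eta> = sets \<gamma>"
    and fin: "relative_entropy \<eta> \<gamma> < \<infinity>"
    and F: "integrable \<eta> F" and exp: "integrable \<gamma> (\<lambda>x. exp (F x))"
  shows "ereal (\<integral>x. F x \<partial>\<eta>) \<le> ereal (ln (\<integral>x. exp (F x) \<partial>\<gamma>)) + relative_entropy \<eta> \<gamma>"
proof -
  interpret G: prob_space \<gamma> by fact
  from assms(1-4) obtain D where D [measurable]: "D \<in> borel_measurable \<gamma>" and D_nonneg: "\<And>x. 0 \<le> D x"
    and dens: "\<eta> = density \<gamma> (\<lambda>x. ennreal (D x))" and D_int: "integrable \<gamma> D"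
    and D_one: "(\<integral>x. D x \<partial>\<gamma>) = 1"
    and ent: "integrable \<gamma> (\<lambda>x. D x * ln (D x))"
    and rel: "relative_entropy \<eta> \<gamma> = ereal (\<integral>x. D x * ln (D x) \<partial>\<gamma>)"
    by (rule finite_relative_entropyE) (rule that)
  have [measurable]: "F \<in> borel_measurable \<gamma>"
    using borel_measurable_integrable[OF F] by (simp add: measurable_cong_sets[OF \<open>sets \<eta> = sets \<gamma>\<close> refl])
  have DF: "integrable \<gamma> (\<lambda>x. D x * F x)" and F_eq: "(\<integral>x. F x \<partial>\<eta>) = (\<integral>x. D x * F x \<partial>\<gamma>)"
    using F by (simp_all add: dens integrable_real_density integral_real_density D_nonneg)
  define Z where "Z = (\<integral>x. exp (F x) \<partial>\<gamma>)"
  have "0 < Z"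
    unfolding Z_def using exp by (intro G.expectation_greater) auto
  have "(\<integral>x. D x * F x \<partial>\<gamma>) - ln Z = (\<integral>x. D x * F x - ln Z * D x \<partial>\<gamma>)"
    using DF D_int D_one by simp
  also have "\<dots> \<le> (\<integral>x. D x * ln (D x) - D x + exp (F x) / Z \<partial>\<gamma>)"
  proof (rule integral_mono)
    fix x
    show "D x * F x - ln Z * D x \<le> D x * ln (D x) - D x + exp (F x) / Z"
      using mult_le_entropy_plus_exp[OF D_nonneg, of x "F x - ln Z"] \<open>0 < Z\<close>
      by (simp add: exp_diff algebra_simps)
  qed (use DF D_int ent exp in auto)
  also have "\<dots> = (\<integral>x. D x * ln (D x) \<partial>\<gamma>)"
    using D_int D_one ent exp \<open>0 < Z\<close> by (simp add: Z_def[symmetric])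
  finally show ?thesis
    by (simp add: rel F_eq Z_def)
qed

text \<open>
  The Donsker-Varadhan inequality for \<open>c (F - \<integral> F d\<gamma>)\<close>, divided by \<open>c\<close>. For a \<open>c\<close> with infinite
  exponential moment the right-hand side is \<open>\<infinity>\<close>.
\<close>

lemma mean_difference_le_risk_sensitive:
  assumes "prob_space \<gamma>" "prob_space \<eta>" and sets: "sets \<eta> = sets \<gamma>"
    and fin: "relative_entropy \<eta> \<gamma> < \<infinity>" and le: "relative_entropy \<eta> \<gamma> \<le> \<rho>"
    and F: "integrable \<eta> F" and c: "0 < c"
  shows "ereal ((\<integral>x. F x \<partial>\<eta>) - (\<integral>x. F x \<partial>\<gamma>)) \<le> risk_sensitive \<gamma> c F + \<rho> / ereal c"
proof -
  interpret E: prob_space \<eta> by fact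
  obtain r where r: "relative_entropy \<eta> \<gamma> = ereal r"
    using assms(1-4) by (rule finite_relative_entropyE) (rule that)
  define m where "m = (\<integral>x. F x \<partial>\<gamma>)"
  define I where "I = (\<integral>\<^sup>+ y. ennreal (exp (c * (F y - m))) \<partial>\<gamma>)"
  have [measurable]: "F \<in> borel_measurable \<gamma>"
    using borel_measurable_integrable[OF F] by (simp add: measurable_cong_sets[OF sets refl])
  have "ereal (r / c) \<le> \<rho> / ereal c"
    using ereal_divide_right_mono[of "ereal r" \<rho> "ereal c"] le c by (simp add: r)
  moreover have "ereal ((\<integral>x. F x \<partial>\<eta>) - m) \<le> risk_sensitive \<gamma> c F + ereal (r / c)"
  proof (cases "I = \<infinity>")
    case True
    then show ?thesis
      by (simp add: risk_sensitive_def I_def m_def)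
  next
    case False
    have exp: "integrable \<gamma> (\<lambda>x. exp (c * (F x - m)))"
      using False by (intro integrableI_nonneg) (auto simp: I_def top.not_eq_extremum)
    then have Z: "(\<integral>x. exp (c * (F x - m)) \<partial>\<gamma>) = enn2real I"
      unfolding I_def by (intro integral_eq_nn_integral) auto
    have "(\<integral>x. c * (F x - m) \<partial>\<eta>) = c * ((\<integral>x. F x \<partial>\<eta>) - m)"
      using F E.prob_space by (subst integral_mult_right_zero) simp
    moreover have "integrable \<eta> (\<lambda>x. c * (F x - m))"
      using F by simp
    ultimately have "c * ((\<integral>x. F x \<partial>\<eta>) - m) \<le> ln (enn2real I) + r"
      using Donsker_Varadhan_inequality[OF assms(1-4) _ exp] by (simp only: r Z plus_ereal.simps ereal_less_eq)
    then have "(\<integral>x. F x \<partial>\<eta>) - m \<le> 1 / c * ln (enn2real I) + r / c"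
      using c by (simp add: field_simps)
    then show ?thesis
      using False by (simp add: risk_sensitive_def I_def m_def)
  qed
  ultimately show ?thesis
    unfolding m_def by (meson add_left_mono order_trans)
qed

theorem corollary1:
  fixes \<nu> :: "'y::polish_space \<Rightarrow> 'z::polish_space measure"
    and h :: "'y \<times> 'z \<Rightarrow> real"
    and \<gamma> lam :: "'y measure"
    and H :: "'y \<Rightarrow> real"
    and \<rho> :: ereal
  assumes kernel: "\<nu> \<in> borel \<rightarrow>\<^sub>M prob_algebra borel"
    and h_meas: "h \<in> borel_measurable (borel \<Otimes>\<^sub>M borel)"
    and h_int: "\<And>y. integrable (\<nu> y) (\<lambda>z. h (y, z))"
    and H_def: "H = marginal_performance \<nu> h"
    and H_meas: "H \<in> borel_measurable borel"
    and gamma: "prob_space \<gamma>" "sets \<gamma> = sets borel"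
    and finite_near_0: "finite_exp_moments_near_0 \<gamma> H"
    and lam: "prob_space lam" "sets lam = sets borel"
    and lam_finite: "relative_entropy lam \<gamma> < \<infinity>"
    and rho_def: "\<rho> = relative_entropy lam \<gamma>"
  shows "\<forall>\<eta>. prob_space \<eta> \<and> sets \<eta> = sets borel \<and> relative_entropy \<eta> \<gamma> \<le> \<rho> \<longrightarrow>
    integrable \<eta> H \<and>
    - (INF c\<in>{0<..}. risk_sensitive \<gamma> c (\<lambda>y. - H y) + \<rho> / ereal c)
      \<le> ereal (kernel_expectation \<eta> \<nu> h - kernel_expectation \<gamma> \<nu> h) \<and>
    ereal (kernel_expectation \<eta> \<nu> h - kernel_expectation \<gamma> \<nu> h)
      \<le> (INF c\<in>{0<..}. risk_sensitive \<gamma> c H + \<rho> / ereal c)"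
proof (intro allI impI, elim conjE)
  fix \<eta> :: "'y measure"
  assume eta: "prob_space \<eta>" "sets \<eta> = sets borel" and le: "relative_entropy \<eta> \<gamma> \<le> \<rho>"
  have sets: "sets \<eta> = sets \<gamma>"
    using eta gamma by simp
  have fin: "relative_entropy \<eta> \<gamma> < \<infinity>"
    using le lam_finite unfolding rho_def by (rule order.strict_trans1)
  note entropy = gamma(1) eta(1) sets fin
  have H_gamma [measurable]: "H \<in> borel_measurable \<gamma>"
    using H_meas by (simp add: measurable_cong_sets[OF gamma(2) refl])
  have int: "integrable \<eta> H"
  proof -
    obtain c0 where "0 < c0"
      and c0: "\<And>c. \<bar>c\<bar> < c0 \<Longrightarrow> (\<integral>\<^sup>+ y. ennreal (exp (c * H y)) \<partial>\<gamma>) < \<infinity>"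
      using finite_near_0 unfolding finite_exp_moments_near_0_def by blast
    have exp: "integrable \<gamma> (\<lambda>y. exp (c * H y))" if "\<bar>c\<bar> < c0" for c
      using c0[OF that] by (intro integrableI_nonneg) auto
    \<comment> \<open>\<open>c0 / 2\<close> and \<open>- (c0 / 2)\<close> lie inside the open interval where the moments are finite.\<close>
    have "integrable \<eta> (\<lambda>y. c0 / 2 * H y)"
      using exp[of "c0 / 2"] exp[of "- (c0 / 2)"] \<open>0 < c0\<close>
      by (intro integrable_if_exp_moments[OF entropy]) auto
    then show ?thesis
      using \<open>0 < c0\<close> by (subst (asm) integrable_mult_left_iff) simp
  qed
  have exp_eq: "kernel_expectation \<mu> \<nu> h = (\<integral>y. H y \<partial>\<mu>)" for \<mu>
    by (simp add: kernel_expectation_def H_def marginal_performance_def)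
  have upper: "ereal (kernel_expectation \<eta> \<nu> h - kernel_expectation \<gamma> \<nu> h)
      \<le> (INF c\<in>{0<..}. risk_sensitive \<gamma> c H + \<rho> / ereal c)"
    unfolding exp_eq
    by (intro INF_greatest mean_difference_le_risk_sensitive[OF entropy le int]) simp
  have "ereal ((\<integral>y. - H y \<partial>\<eta>) - (\<integral>y. - H y \<partial>\<gamma>))
      \<le> (INF c\<in>{0<..}. risk_sensitive \<gamma> c (\<lambda>y. - H y) + \<rho> / ereal c)"
    using int by (intro INF_greatest mean_difference_le_risk_sensitive[OF entropy le]) auto
  then have "- ereal (kernel_expectation \<eta> \<nu> h - kernel_expectation \<gamma> \<nu> h)
      \<le> (INF c\<in>{0<..}. risk_sensitive \<gamma> c (\<lambda>y. - H y) + \<rho> / ereal c)"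
    by (simp add: exp_eq)
  then have lower: "- (INF c\<in>{0<..}. risk_sensitive \<gamma> c (\<lambda>y. - H y) + \<rho> / ereal c)
      \<le> ereal (kernel_expectation \<eta> \<nu> h - kernel_expectation \<gamma> \<nu> h)"
    by (subst ereal_uminus_le_reorder)
  from int lower upper show "integrable \<eta> H \<and>
    - (INF c\<in>{0<..}. risk_sensitive \<gamma> c (\<lambda>y. - H y) + \<rho> / ereal c)
      \<le> ereal (kernel_expectation \<eta> \<nu> h - kernel_expectation \<gamma> \<nu> h) \<and>
    ereal (kernel_expectation \<eta> \<nu> h - kernel_expectation \<gamma> \<nu> h)
      \<le> (INF c\<in>{0<..}. risk_sensitive \<gamma> c H + \<rho> / ereal c)"
    by blast
qed

end
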